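(* For every $n\ge3$, the cycle on $n$ vertices is $123$-representable.
   Context: A word is a finite sequence of letters from a totally ordered alphabet. Two letters $x,y$ alternate in a word $w$ if between any two occurrences of $x$ there is an occurrence of $y$ and between any two occurrences of $y$ there is an occurrence of $x$. A graph $G=(V,E)$ is represented by a word $w$ over $V$ if for all distinct $x,y\in V$, $x$ and $y$ alternate in $w$ if and only if $xy\in E$. A word is $123$-avoiding if it has no strictly increasing subsequence of length $3$. A graph is $123$-representable if, after labeling its vertices by distinct elements of a totally ordered set (any labeling may be chosen), it is represented by a $123$-avoiding word. *)

theory Defs
  imports Main
begin

text \<open>A graph is given by its vertex set \<open>V\<close> and its set \<open>E\<close> of edges, each edge being
  a two-element set of vertices.\<close>

definition separated_by :: "'a \<Rightarrow> 'a \<Rightarrow> 'a list \<Rightarrow> bool" where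
  "separated_by x y w \<longleftrightarrow>
     (\<forall>i j. i < j \<and> j < length w \<and> w ! i = x \<and> w ! j = x \<longrightarrow> (\<exists>k. i < k \<and> k < j \<and> w ! k = y))"

definition alternate :: "'a \<Rightarrow> 'a \<Rightarrow> 'a list \<Rightarrow> bool" where
  "alternate x y w \<longleftrightarrow> separated_by x y w \<and> separated_by y x w"

text \<open>Following the usual convention for word-representable graphs, a word representing a
  graph has to contain every vertex at least once; hence \<open>set w = V\<close> rather than merely
  \<open>set w \<subseteq> V\<close>.\<close>

definition represents :: "'a list \<Rightarrow> 'a set \<Rightarrow> 'a set set \<Rightarrow> bool" where
  "represents w V E \<longleftrightarrow>
     set w = V \<and> (\<forall>x\<in>V. \<forall>y\<in>V. x \<noteq> y \<longrightarrow> (alternate x y w \<longleftrightarrow> {x, y} \<in> E))"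

definition avoids_123 :: "'a::linorder list \<Rightarrow> bool" where
  "avoids_123 w \<longleftrightarrow>
     \<not> (\<exists>i j k. i < j \<and> j < k \<and> k < length w \<and> w ! i < w ! j \<and> w ! j < w ! k)"

text \<open>For a finite graph, natural-number labels are no restriction: only the relative order
  of the finitely many labels matters.\<close>

definition representable_123 :: "'a set \<Rightarrow> 'a set set \<Rightarrow> bool" where
  "representable_123 V E \<longleftrightarrow>
     (\<exists>(f :: 'a \<Rightarrow> nat) w. inj_on f V \<and> avoids_123 w \<and> represents w (f ` V) ((`) f ` E))"

definition cycle_vertices :: "nat \<Rightarrow> nat set" where
  "cycle_vertices n = {0..<n}"

definition cycle_edges :: "nat \<Rightarrow> nat set set" where
  "cycle_edges n = {{i, Suc i mod n} | i. i < n}"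

end

theory Submission
  imports Defs
begin

text \<open>Writing the letters as crossing pairs of chords around a circle, the cycle is represented by
  the cyclic word \<open>0 (n-1) 1 0 2 1 3 2 \<dots> (n-1) (n-2)\<close>, in which every letter occurs twice, and
  cutting this circle at any place yields a representing word. Since the occurrences of \<open>i\<close>
  precede those of \<open>i + 2\<close> away from the cut, the letters of each parity can be labelled
  decreasingly; letting the parity of \<open>n - 1\<close> have the larger labels, and cutting before the
  displayed word for odd \<open>n\<close> and one place later for even \<open>n\<close>, the labelled word splits
  into two weakly decreasing subsequences and therefore avoids 123.\<close>

text \<open>Among three positions, two share a colour. The colouring is on positions, not letters,
  so two occurrences of one letter may get different colours.\<close>

lemma avoids_123_if_two_decreasing:
  assumes "\<And>i j. i < j \<Longrightarrow> j < length w \<Longrightarrow> (c i :: bool) = c j \<Longrightarrow> w ! j \<le> w ! i"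
  shows "avoids_123 w"
  unfolding avoids_123_def
proof clarify
  fix i j k
  assume h: "i < j" "j < k" "k < length w" "w ! i < w ! j" "w ! j < w ! k"
  consider "c i = c j" | "c j = c k" | "c i = c k" by blast
  then show False
    using assms[of i j] assms[of j k] assms[of i k] h by cases auto
qed

lemma separated_by_map:
  assumes "inj_on f (insert x (insert y (set w)))"
  shows "separated_by (f x) (f y) (map f w) \<longleftrightarrow> separated_by x y w"
proof -
  have eq: "map f w ! i = f z \<longleftrightarrow> w ! i = z" if "i < length w" "z = x \<or> z = y" for i z
    using that inj_on_eq_iff[OF assms, of "w ! i" z] by auto
  show ?thesis
    unfolding separated_by_def length_map
  proof (intro all_cong1)
    fix i j
    show "(i < j \<and> j < length w \<and> map f w ! i = f x \<and> map f w ! j = f x \<longrightarrow>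
        (\<exists>k. i < k \<and> k < j \<and> map f w ! k = f y)) \<longleftrightarrow>
      (i < j \<and> j < length w \<and> w ! i = x \<and> w ! j = x \<longrightarrow> (\<exists>k. i < k \<and> k < j \<and> w ! k = y))"
    proof (cases "i < j \<and> j < length w")
      case True
      then have "k < j \<Longrightarrow> map f w ! k = f y \<longleftrightarrow> w ! k = y" for k
        by (intro eq) auto
      then have "(\<exists>k. i < k \<and> k < j \<and> map f w ! k = f y) \<longleftrightarrow> (\<exists>k. i < k \<and> k < j \<and> w ! k = y)"
        by blast
      moreover have "map f w ! i = f x \<longleftrightarrow> w ! i = x" "map f w ! j = f x \<longleftrightarrow> w ! j = x"
        using True by (auto intro!: eq simp del: nth_map)
      ultimately show ?thesis by (simp only:)
    qed blast
  qed
qed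

text \<open>Alternation depends only on which entries are equal, so an injective relabelling
  preserves it; edges lying inside \<open>V\<close> can be recovered from their images.\<close>

lemma represents_map:
  assumes "represents w V E" "inj_on f V" "\<And>e. e \<in> E \<Longrightarrow> e \<subseteq> V"
  shows "represents (map f w) (f ` V) ((`) f ` E)"
proof -
  have setw: "set w = V" using assms(1) by (simp add: represents_def)
  have "alternate (f x) (f y) (map f w) \<longleftrightarrow> {f x, f y} \<in> (`) f ` E"
    if "x \<in> V" "y \<in> V" "f x \<noteq> f y" for x y
  proof -
    have "alternate (f x) (f y) (map f w) \<longleftrightarrow> alternate x y w"
      using that assms(2) setw
      by (simp add: alternate_def separated_by_map insert_absorb)
    also have "\<dots> \<longleftrightarrow> {x, y} \<in> E"
      using assms(1) that by (auto simp: represents_def)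
    also have "\<dots> \<longleftrightarrow> f ` {x, y} \<in> (`) f ` E"
    proof
      assume "f ` {x, y} \<in> (`) f ` E"
      then obtain e where e: "e \<in> E" "f ` {x, y} = f ` e" by blast
      then have "{x, y} = e"
        using inj_on_image_eq_iff[OF assms(2), of "{x, y}" e] assms(3) that by simp
      with e show "{x, y} \<in> E" by simp
    qed blast
    finally show ?thesis by simp
  qed
  then show ?thesis using setw by (auto simp: represents_def)
qed

lemma separated_by_two_occurrences:
  assumes "\<And>t. t < length w \<Longrightarrow> w ! t = x \<longleftrightarrow> t = p \<or> t = q"
    and "\<And>t. t < length w \<Longrightarrow> w ! t = y \<longleftrightarrow> t = p' \<or> t = q'"
    and "p < q" "q < length w"
  shows "separated_by x y w \<longleftrightarrow> (p < p' \<and> p' < q) \<or> (p < q' \<and> q' < q)"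
proof
  assume "separated_by x y w"
  moreover have "w ! p = x" "w ! q = x" using assms by auto
  ultimately obtain k where "p < k" "k < q" "w ! k = y"
    using assms(3,4) unfolding separated_by_def by blast
  then show "(p < p' \<and> p' < q) \<or> (p < q' \<and> q' < q)" using assms(2)[of k] assms(4) by auto
next
  assume R: "(p < p' \<and> p' < q) \<or> (p < q' \<and> q' < q)"
  then obtain k where k: "p < k" "k < q" "w ! k = y"
    using assms(2,4) order.strict_trans by metis
  have "i = p \<and> j = q" if "i < j" "j < length w" "w ! i = x" "w ! j = x" for i j
    using that assms(1)[of i] assms(1)[of j] assms(3) by auto
  then show "separated_by x y w" unfolding separated_by_def using k by blast
qed

text \<open>With two occurrences per letter, alternation means that the chords from \<open>p\<close>
  to \<open>q\<close> and from \<open>p'\<close> to \<open>q'\<close> cross;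
  \<open>x \<noteq> y\<close> makes the four endpoints distinct.\<close>

lemma alternate_two_occurrences:
  assumes "\<And>t. t < length w \<Longrightarrow> w ! t = x \<longleftrightarrow> t = p \<or> t = q"
    and "\<And>t. t < length w \<Longrightarrow> w ! t = y \<longleftrightarrow> t = p' \<or> t = q'"
    and "p < q" "q < length w" "p' < q'" "q' < length w" "x \<noteq> y"
  shows "alternate x y w \<longleftrightarrow> (p < p' \<and> p' < q \<and> q < q') \<or> (p' < p \<and> p < q' \<and> q' < q)"
proof -
  have "p \<noteq> p'" "p \<noteq> q'" "q \<noteq> p'" "q \<noteq> q'"
    using assms(1)[of p] assms(1)[of q] assms(2)[of p] assms(2)[of q] assms(3-7) by auto
  moreover have "separated_by x y w \<longleftrightarrow> (p < p' \<and> p' < q) \<or> (p < q' \<and> q' < q)"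
    by (rule separated_by_two_occurrences) (fact assms)+
  moreover have "separated_by y x w \<longleftrightarrow> (p' < p \<and> p < q') \<or> (p' < q \<and> q < q')"
    by (rule separated_by_two_occurrences) (fact assms)+
  ultimately show ?thesis
    unfolding alternate_def using assms(3,5) by linarith
qed

lemma cycle_edges_iff:
  assumes "x < y" "y < n"
  shows "{x, y} \<in> cycle_edges n \<longleftrightarrow> y = Suc x \<or> (x = 0 \<and> Suc y = n)"
proof
  assume "{x, y} \<in> cycle_edges n"
  then obtain i where "i < n" "{x, y} = {i, Suc i mod n}" by (auto simp: cycle_edges_def)
  then show "y = Suc x \<or> (x = 0 \<and> Suc y = n)"
    using assms by (cases "Suc i = n") (auto simp: doubleton_eq_iff)
next
  assume "y = Suc x \<or> (x = 0 \<and> Suc y = n)"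
  then show "{x, y} \<in> cycle_edges n"
  proof
    assume "y = Suc x"
    then show ?thesis using assms by (auto simp: cycle_edges_def intro!: exI[of _ x])
  next
    assume "x = 0 \<and> Suc y = n"
    then show ?thesis using assms by (auto simp: cycle_edges_def intro!: exI[of _ y])
  qed
qed

text \<open>Reduces representation to arithmetic on chord endpoints; pairs with \<open>x < y\<close>
  suffice, as alternation and edges are symmetric.\<close>

lemma represents_cycleI:
  assumes occ: "\<And>x t. x < n \<Longrightarrow> t < length w \<Longrightarrow> w ! t = x \<longleftrightarrow> t = p x \<or> t = q x"
    and pq: "\<And>x. x < n \<Longrightarrow> p x < q x \<and> q x < length w"
    and "set w \<subseteq> {0..<n}"
    and cross: "\<And>x y. x < y \<Longrightarrow> y < n \<Longrightarrow>
      (p x < p y \<and> p y < q x \<and> q x < q y) \<or> (p y < p x \<and> p x < q y \<and> q y < q x) \<longleftrightarrow>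
      y = Suc x \<or> (x = 0 \<and> Suc y = n)"
  shows "represents w (cycle_vertices n) (cycle_edges n)"
proof -
  have "x \<in> set w" if "x < n" for x
    using occ[OF that, of "q x"] pq[OF that] nth_mem by metis
  then have setw: "set w = cycle_vertices n"
    using assms(3) by (auto simp: cycle_vertices_def)
  have less: "alternate x y w \<longleftrightarrow> {x, y} \<in> cycle_edges n" if "x < y" "y < n" for x y
  proof -
    have "alternate x y w \<longleftrightarrow>
        (p x < p y \<and> p y < q x \<and> q x < q y) \<or> (p y < p x \<and> p x < q y \<and> q y < q x)"
      using that pq[of x] pq[of y] occ[of x] occ[of y]
      by (intro alternate_two_occurrences) auto
    then show ?thesis using cross[OF that] cycle_edges_iff[OF that] by simp
  qed
  have "alternate x y w \<longleftrightarrow> {x, y} \<in> cycle_edges n" if "x < n" "y < n" "x \<noteq> y" for x y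
    using less[of x y] less[of y x] that
    by (metis alternate_def insert_commute linorder_neqE_nat)
  then show ?thesis using setw by (auto simp: represents_def cycle_vertices_def)
qed

text \<open>For \<open>i < n\<close> the branches take values in \<open>1..n\<close> and
  \<open>n+1..2n\<close>, so they never collide.\<close>

definition cycle_label :: "nat \<Rightarrow> nat \<Rightarrow> nat" where
  "cycle_label n i = (if even (n + i) then n - i else 2 * n - i)"

lemma inj_on_cycle_label: "inj_on (cycle_label n) {0..<n}"
proof (rule inj_onI)
  fix i j assume "i \<in> {0..<n}" "j \<in> {0..<n}" "cycle_label n i = cycle_label n j"
  then have "i < n" "j < n"
    "n - i = n - j \<or> 2 * n - i = 2 * n - j \<or>
      n - i = 2 * n - j \<or> 2 * n - i = n - j"
    unfolding cycle_label_def by (simp_all split: if_splits)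
  then show "i = j" by linarith
qed

text \<open>Letter \<open>i\<close> sits at \<open>2 * i\<close> and \<open>2 * i + 3\<close> modulo
  \<open>2 * n\<close>; only \<open>n - 1\<close> wraps around, to position 1.\<close>

definition odd_cycle_word :: "nat \<Rightarrow> nat list" where
  "odd_cycle_word n = map (\<lambda>t. if even t then t div 2 else if t = 1 then n - 1 else (t - 3) div 2)
     [0..<2 * n]"

text \<open>The previous word with its initial 0 moved to the end, so all other positions drop by
  one.\<close>

definition even_cycle_word :: "nat \<Rightarrow> nat list" where
  "even_cycle_word n = map (\<lambda>t. if t = 0 then n - 1 else if t = 2 * n - 1 then 0
     else if odd t then (t + 1) div 2 else (t - 2) div 2) [0..<2 * n]"

text \<open>For unwrapped chords, \<open>2 * x < 2 * y < 2 * x + 3\<close> forces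
  \<open>y = Suc x\<close>. The chord of \<open>n - 1\<close>, from 1 to \<open>2 * n - 2\<close>,
  crosses only those of 0 and \<open>n - 2\<close> and encloses the rest.\<close>

lemma represents_odd_cycle_word:
  assumes "n \<ge> 3"
  shows "represents (odd_cycle_word n) (cycle_vertices n) (cycle_edges n)"
proof -
  let ?p = "\<lambda>i. if Suc i = n then 1 else 2 * i"
  let ?q = "\<lambda>i. if Suc i = n then 2 * i else 2 * i + 3"
  show ?thesis
  proof (rule represents_cycleI[where p = ?p and q = ?q])
    fix x t assume "x < n" "t < length (odd_cycle_word n)"
    \<comment> \<open>Position 1 is kept apart because \<open>t - 3\<close> would truncate
      there.\<close>
    moreover have "\<exists>k. t = 2 * k \<or> t = 1 \<or> t = 2 * k + 3" by presburger
    ultimately show "odd_cycle_word n ! t = x \<longleftrightarrow> t = ?p x \<or> t = ?q x"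
      using assms by (auto simp: odd_cycle_word_def; presburger)
  next
    fix x y assume "x < y" "y < n"
    then show "(?p x < ?p y \<and> ?p y < ?q x \<and> ?q x < ?q y) \<or>
        (?p y < ?p x \<and> ?p x < ?q y \<and> ?q y < ?q x) \<longleftrightarrow> y = Suc x \<or> (x = 0 \<and> Suc y = n)"
      using assms by (cases "Suc y = n"; simp; arith)
  qed (use assms in \<open>auto simp: odd_cycle_word_def\<close>)
qed

lemma represents_even_cycle_word:
  assumes "n \<ge> 3"
  shows "represents (even_cycle_word n) (cycle_vertices n) (cycle_edges n)"
proof -
  let ?p = "\<lambda>i. if i = 0 then 2 else if Suc i = n then 0 else 2 * i - 1"
  let ?q = "\<lambda>i. if i = 0 then 2 * n - 1 else if Suc i = n then 2 * i - 1 else 2 * i + 2"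
  show ?thesis
  proof (rule represents_cycleI[where p = ?p and q = ?q])
    fix x t assume "x < n" "t < length (even_cycle_word n)"
    moreover have "\<exists>k. t = 2 * k + 1 \<or> t = 0 \<or> t = 2 * k + 2" by presburger
    ultimately show "even_cycle_word n ! t = x \<longleftrightarrow> t = ?p x \<or> t = ?q x"
      using assms by (auto simp: even_cycle_word_def; presburger)
  next
    fix x y assume "x < y" "y < n"
    then show "(?p x < ?p y \<and> ?p y < ?q x \<and> ?q x < ?q y) \<or>
        (?p y < ?p x \<and> ?p x < ?q y \<and> ?q y < ?q x) \<longleftrightarrow> y = Suc x \<or> (x = 0 \<and> Suc y = n)"
      using assms by (cases "Suc y = n"; cases "x = 0"; simp; arith)
  next
    show "set (even_cycle_word n) \<subseteq> {0..<n}"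
      using assms by (auto simp: even_cycle_word_def; presburger)
  qed (use assms in \<open>auto simp: even_cycle_word_def\<close>)
qed

text \<open>The two decreasing subsequences are the letters of each parity, except that next to the cut
  an occurrence of the smallest letter of the high class is moved to the front of the low one,
  and, for even \<open>n\<close>, an occurrence of the largest letter of the low class is moved to the end of
  the high one.\<close>

lemma avoids_123_odd_cycle_word:
  assumes "n \<ge> 3" "odd n"
  shows "avoids_123 (map (cycle_label n) (odd_cycle_word n))"
proof (rule avoids_123_if_two_decreasing[where
      c = "\<lambda>t. t \<noteq> 1 \<and> even (odd_cycle_word n ! t)"])
  fix i j
  assume "i < j" "j < length (map (cycle_label n) (odd_cycle_word n))"
    "(i \<noteq> 1 \<and> even (odd_cycle_word n ! i)) = (j \<noteq> 1 \<and> even (odd_cycle_word n ! j))"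
  \<comment> \<open>Away from the cut a later letter is smaller by at most one, which equal parity
    excludes.\<close>
  moreover have "i div 2 \<le> (j - 3) div 2"
    if "even i" "odd j" "j \<noteq> 1" "even (i div 2) = even ((j - 3) div 2)"
    using that \<open>i < j\<close> by presburger
  ultimately show "map (cycle_label n) (odd_cycle_word n) ! j \<le>
      map (cycle_label n) (odd_cycle_word n) ! i"
    using assms by (auto simp: odd_cycle_word_def cycle_label_def split: if_splits)
qed

lemma avoids_123_even_cycle_word:
  assumes "n \<ge> 3" "even n"
  shows "avoids_123 (map (cycle_label n) (even_cycle_word n))"
proof (rule avoids_123_if_two_decreasing[where
      c = "\<lambda>t. t = 2 * n - 1 \<or> t \<noteq> 0 \<and> odd (even_cycle_word n ! t)"])
  fix i j
  assume "i < j" "j < length (map (cycle_label n) (even_cycle_word n))"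
    "(i = 2 * n - 1 \<or> i \<noteq> 0 \<and> odd (even_cycle_word n ! i)) =
     (j = 2 * n - 1 \<or> j \<noteq> 0 \<and> odd (even_cycle_word n ! j))"
  \<comment> \<open>Again a drop of exactly one is the only possible descent, and parity rules it
    out.\<close>
  moreover have "(i + 1) div 2 \<le> (j - 2) div 2"
    if "odd i" "even j" "even ((i + 1) div 2) = even ((j - 2) div 2)"
    using that \<open>i < j\<close> by presburger
  ultimately show "map (cycle_label n) (even_cycle_word n) ! j \<le>
      map (cycle_label n) (even_cycle_word n) ! i"
    using assms by (auto simp: even_cycle_word_def cycle_label_def split: if_splits)
qed

theorem theorem3p11:
  fixes n :: nat
  assumes "n \<ge> 3"
  shows "representable_123 (cycle_vertices n) (cycle_edges n)"
proof -
  \<comment> \<open>Both words represent the cycle; the parity of \<open>n\<close> selects the one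
    shown to avoid 123.\<close>
  obtain w where w: "represents w (cycle_vertices n) (cycle_edges n)"
      "avoids_123 (map (cycle_label n) w)"
    using assms represents_odd_cycle_word represents_even_cycle_word
      avoids_123_odd_cycle_word avoids_123_even_cycle_word by metis
  have inj: "inj_on (cycle_label n) (cycle_vertices n)"
    by (simp add: cycle_vertices_def inj_on_cycle_label)
  have "e \<subseteq> cycle_vertices n" if "e \<in> cycle_edges n" for e
    using that by (auto simp: cycle_edges_def cycle_vertices_def)
  then show ?thesis
    unfolding representable_123_def using represents_map[OF w(1) inj] w(2) inj by blast
qed

end
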